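(* Let $\mathbb{S}\subset\mathbb{R}^2$ be the Sierpinski gasket, regarded as a tri-pointed metric space with the Euclidean metric, and let $\sigma:\mathbb{S}\to M\otimes\mathbb{S}$ be the inverse of the bijection $\tau: M\otimes\mathbb{S}\to\mathbb{S}$, $\tau(m\otimes x)=\sigma_m(x)$. Then $(\mathbb{S},\sigma)$ is the final coalgebra for the endofunctor $F=M\otimes -$ on the category $\mathbf{Met}_3^{C}$ of tri-pointed metric spaces and continuous maps preserving the distinguished points.
   Context: A tri-pointed set is a set $X$ with three distinguished elements $T,L,R$ (written $T_X,L_X,R_X$). A tri-pointed metric space is a tri-pointed set with a metric $d$ satisfying $d(x,y)\le 1$ for all $x,y$ and such that any two different ones of the distinguished elements are at distance exactly $1$. $\mathbf{Met}_3^{C}$ is the category of tri-pointed metric spaces whose morphisms are the continuous maps preserving $T,L,R$. Let $M=\{a,b,c\}$. For a tri-pointed set $X$, $M\otimes X$ is the quotient of $M\times X$ by the equivalence relation generated by $(b,T)\sim(a,L)$, $(a,R)\sim(c,T)$, $(c,L)\sim(b,R)$; the class of $(m,x)$ is written $m\otimes x$. Its distinguished elements are $T_{M\otimes X}=a\otimes T$, $L_{M\otimes X}=b\otimes L$, $R_{M\otimes X}=c\otimes R$. If $X$ is a tri-pointed metric space, $M\times X$ has the metric $d((m,x),(n,y))=\frac12 d(x,y)$ if $m=n$ and $1$ if $m\ne n$, and $M\otimes X$ has the quotient metric, which is explicitly: $d(m\otimes x,m\otimes y)=\frac12 d(x,y)$; $d(a\otimes x,b\otimes y)=\frac12\min\{d(x,L)+d(T,y),\,d(x,R)+1+d(R,y)\}$;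 $d(a\otimes x,c\otimes y)=\frac12\min\{d(x,R)+d(T,y),\,d(x,L)+1+d(L,y)\}$; $d(b\otimes x,c\otimes y)=\frac12\min\{d(x,R)+d(L,y),\,d(x,T)+1+d(T,y)\}$. This is again a tri-pointed metric space. The functor $F=M\otimes -$ acts on morphisms by $(M\otimes f)(m\otimes x)=m\otimes f(x)$. An $F$-coalgebra is a pair $(X,e)$ with $e:X\to F(X)$ a morphism of the category; a coalgebra morphism $(X,e)\to(Y,e')$ is a morphism $f:X\to Y$ with $e'\circ f=F(f)\circ e$; a coalgebra is final if every coalgebra has exactly one coalgebra morphism to it. Let $\sigma_a(x,y)=(x/2,y/2)+(1/4,\sqrt3/4)$, $\sigma_b(x,y)=(x/2,y/2)$, $\sigma_c(x,y)=(x/2,y/2)+(1/2,0)$ on $\mathbb{R}^2$. $\mathbb{S}$ is the unique nonempty compact subset of $\mathbb{R}^2$ with $\mathbb{S}=\sigma_a(\mathbb{S})\cup\sigma_b(\mathbb{S})\cup\sigma_c(\mathbb{S})$, with distinguished points $T=(1/2,\sqrt3/2)$, $L=(0,0)$, $R=(1,0)$. The map $\tau$ is a well-defined bijection preserving distinguished elements. *)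

theory Defs
  imports "HOL-Analysis.Analysis"
begin

section \<open>Tri-pointed metric spaces\<close>

record 'a tri_space =
  pts :: "'a set"
  dst :: "'a \<Rightarrow> 'a \<Rightarrow> real"
  ptT :: 'a
  ptL :: 'a
  ptR :: 'a

text \<open>\<^const>\<open>Metric_space\<close> asks the distance function to be symmetric and nonnegative on the whole
  type; this is no restriction, as its values outside the carrier can be taken to be 0.\<close>

definition tri_metric :: "'a tri_space \<Rightarrow> bool" where
  "tri_metric X \<longleftrightarrow>
     Metric_space (pts X) (dst X) \<and>
     (\<forall>x\<in>pts X. \<forall>y\<in>pts X. dst X x y \<le> 1) \<and>
     ptT X \<in> pts X \<and> ptL X \<in> pts X \<and> ptR X \<in> pts X \<and>
     dst X (ptT X) (ptL X) = 1 \<and> dst X (ptT X) (ptR X) = 1 \<and> dst X (ptL X) (ptR X) = 1"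

definition tri_top :: "'a tri_space \<Rightarrow> 'a topology" where
  "tri_top X = Metric_space.mtopology (pts X) (dst X)"

definition tri_morphism :: "'a tri_space \<Rightarrow> 'b tri_space \<Rightarrow> ('a \<Rightarrow> 'b) \<Rightarrow> bool" where
  "tri_morphism X Y f \<longleftrightarrow>
     continuous_map (tri_top X) (tri_top Y) f \<and>
     f (ptT X) = ptT Y \<and> f (ptL X) = ptL Y \<and> f (ptR X) = ptR Y"

section \<open>Quotient metrics\<close>

text \<open>A chain from \<open>P\<close> to \<open>Q\<close> is a nonempty list of jumps \<open>(p, q)\<close> in \<open>S \<times> S\<close>, where the end of
  each jump is equivalent to the beginning of the next one.\<close>

definition quot_chain :: "'a set \<Rightarrow> ('a \<times> 'a) set \<Rightarrow> 'a set \<Rightarrow> 'a set \<Rightarrow> ('a \<times> 'a) list \<Rightarrow> bool" where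
  "quot_chain S r P Q js \<longleftrightarrow>
     js \<noteq> [] \<and> set js \<subseteq> S \<times> S \<and> fst (hd js) \<in> P \<and> snd (last js) \<in> Q \<and>
     successively (\<lambda>j j'. (snd j, fst j') \<in> r) js"

text \<open>The value 0 outside the quotient is what \<^const>\<open>Metric_space\<close> needs.\<close>

definition quot_dist ::
    "'a set \<Rightarrow> ('a \<Rightarrow> 'a \<Rightarrow> real) \<Rightarrow> ('a \<times> 'a) set \<Rightarrow> 'a set \<Rightarrow> 'a set \<Rightarrow> real" where
  "quot_dist S d r P Q =
     (if P \<in> S // r \<and> Q \<in> S // r
      then Inf {(\<Sum>(p, q)\<leftarrow>js. d p q) | js. quot_chain S r P Q js} else 0)"

section \<open>The functor\<close>

datatype idx = Ma | Mb | Mc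

definition copies :: "'a tri_space \<Rightarrow> (idx \<times> 'a) set" where
  "copies X = UNIV \<times> pts X"

definition copies_dist :: "'a tri_space \<Rightarrow> idx \<times> 'a \<Rightarrow> idx \<times> 'a \<Rightarrow> real" where
  "copies_dist X p q = (if fst p = fst q then dst X (snd p) (snd q) / 2 else 1)"

definition glue :: "'a tri_space \<Rightarrow> ((idx \<times> 'a) \<times> (idx \<times> 'a)) set" where
  "glue X = {((Mb, ptT X), (Ma, ptL X)), ((Ma, ptR X), (Mc, ptT X)), ((Mc, ptL X), (Mb, ptR X))}"

definition glue_equiv :: "'a tri_space \<Rightarrow> ((idx \<times> 'a) \<times> (idx \<times> 'a)) set" where
  "glue_equiv X = Restr ((glue X \<union> (glue X)\<inverse>)\<^sup>*) (copies X)"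

definition tens :: "'a tri_space \<Rightarrow> idx \<Rightarrow> 'a \<Rightarrow> (idx \<times> 'a) set" where
  "tens X m x = glue_equiv X `` {(m, x)}"

definition tensor :: "'a tri_space \<Rightarrow> (idx \<times> 'a) set tri_space" where
  "tensor X =
     \<lparr>pts = copies X // glue_equiv X,
      dst = quot_dist (copies X) (copies_dist X) (glue_equiv X),
      ptT = tens X Ma (ptT X), ptL = tens X Mb (ptL X), ptR = tens X Mc (ptR X)\<rparr>"

text \<open>The image of a class, saturated; see \<open>tensor_map_tens\<close> below.\<close>

definition tensor_map ::
    "'b tri_space \<Rightarrow> ('a \<Rightarrow> 'b) \<Rightarrow> (idx \<times> 'a) set \<Rightarrow> (idx \<times> 'b) set" where
  "tensor_map Y f P = glue_equiv Y `` ((\<lambda>(m, x). (m, f x)) ` P)"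

section \<open>Coalgebras\<close>

definition coalgebra :: "'a tri_space \<Rightarrow> ('a \<Rightarrow> (idx \<times> 'a) set) \<Rightarrow> bool" where
  "coalgebra X e \<longleftrightarrow> tri_metric X \<and> tri_morphism X (tensor X) e"

definition coalgebra_morphism ::
    "'a tri_space \<Rightarrow> ('a \<Rightarrow> (idx \<times> 'a) set) \<Rightarrow> 'b tri_space \<Rightarrow> ('b \<Rightarrow> (idx \<times> 'b) set) \<Rightarrow>
     ('a \<Rightarrow> 'b) \<Rightarrow> bool" where
  "coalgebra_morphism X e Y e' f \<longleftrightarrow>
     tri_morphism X Y f \<and> (\<forall>x\<in>pts X. e' (f x) = tensor_map Y f (e x))"

text \<open>Finality among the coalgebras whose points are taken from the type \<open>'a\<close>; full finality is
  this property for arbitrary \<open>'a\<close>. Since functions are total, maps out of \<open>X\<close> are identified with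
  their extensional representatives.\<close>

definition final_coalgebra ::
    "'a itself \<Rightarrow> 'b tri_space \<Rightarrow> ('b \<Rightarrow> (idx \<times> 'b) set) \<Rightarrow> bool" where
  "final_coalgebra TYPE('a) Y e' \<longleftrightarrow>
     coalgebra Y e' \<and>
     (\<forall>(X :: 'a tri_space) e. coalgebra X e \<longrightarrow>
        (\<exists>!f. f \<in> extensional (pts X) \<and> coalgebra_morphism X e Y e' f))"

section \<open>The Sierpinski gasket\<close>

text \<open>The product type \<open>real \<times> real\<close> carries the Euclidean distance.\<close>

fun contraction :: "idx \<Rightarrow> real \<times> real \<Rightarrow> real \<times> real" where
  "contraction Ma (x, y) = (x / 2 + 1 / 4, y / 2 + sqrt 3 / 4)"
| "contraction Mb (x, y) = (x / 2, y / 2)"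
| "contraction Mc (x, y) = (x / 2 + 1 / 2, y / 2)"

definition sierpinski :: "(real \<times> real) set" where
  "sierpinski = (THE K. K \<noteq> {} \<and> compact K \<and>
     K = contraction Ma ` K \<union> contraction Mb ` K \<union> contraction Mc ` K)"

definition gasket :: "(real \<times> real) tri_space" where
  "gasket = \<lparr>pts = sierpinski, dst = dist, ptT = (1 / 2, sqrt 3 / 2), ptL = (0, 0), ptR = (1, 0)\<rparr>"

text \<open>\<open>contraction\<close> is constant on each class; see \<open>gasket_tau_tens\<close> below.\<close>

definition gasket_tau :: "(idx \<times> (real \<times> real)) set \<Rightarrow> real \<times> real" where
  "gasket_tau P = the_elem ((\<lambda>(m, x). contraction m x) ` P)"

definition gasket_sigma :: "real \<times> real \<Rightarrow> (idx \<times> (real \<times> real)) set" where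
  "gasket_sigma = inv_into (pts (tensor gasket)) gasket_tau"

section \<open>Elementary properties of the functor\<close>

lemma equiv_glue_equiv: "equiv (copies X) (glue_equiv X)"
proof -
  have "sym ((glue X \<union> (glue X)\<inverse>)\<^sup>*)"
    by (intro sym_rtrancl) (auto simp: sym_def)
  then show ?thesis
    unfolding glue_equiv_def equiv_def refl_on_def sym_def trans_def
    by (auto intro: rtrancl_trans)
qed

lemma glue_equiv_invariant:
  assumes "(p, q) \<in> glue_equiv X" and "\<And>p q. (p, q) \<in> glue X \<Longrightarrow> f p = f q"
  shows "f p = f q"
proof -
  have "(p, q) \<in> (glue X \<union> (glue X)\<inverse>)\<^sup>*"
    using assms(1) by (auto simp: glue_equiv_def)
  then show ?thesis
    by induction (use assms(2) in force)+
qed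

lemma tens_in_tensor: "x \<in> pts X \<Longrightarrow> tens X m x \<in> pts (tensor X)"
  by (auto simp: tensor_def tens_def copies_def intro: quotientI)

lemma tensor_cases:
  assumes "P \<in> pts (tensor X)"
  obtains m x where "x \<in> pts X" "P = tens X m x"
  using assms by (auto simp: tensor_def tens_def copies_def elim!: quotientE)

lemma tens_eq_iff:
  assumes "x \<in> pts X" "y \<in> pts X"
  shows "tens X m x = tens X n y \<longleftrightarrow> ((m, x), (n, y)) \<in> glue_equiv X"
  unfolding tens_def using assms
  by (intro eq_equiv_class_iff[OF equiv_glue_equiv]) (auto simp: copies_def)

lemma tens_glue:
  assumes "ptT X \<in> pts X" "ptL X \<in> pts X" "ptR X \<in> pts X"
  shows "tens X Mb (ptT X) = tens X Ma (ptL X)"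
    and "tens X Ma (ptR X) = tens X Mc (ptT X)"
    and "tens X Mc (ptL X) = tens X Mb (ptR X)"
  using assms
  by (auto simp: tens_eq_iff glue_equiv_def glue_def copies_def intro!: r_into_rtrancl)

lemma tensor_map_tens:
  assumes f: "f ` pts X \<subseteq> pts Y"
      and fT: "f (ptT X) = ptT Y" and fL: "f (ptL X) = ptL Y" and fR: "f (ptR X) = ptR Y"
      and Y: "ptT Y \<in> pts Y" "ptL Y \<in> pts Y" "ptR Y \<in> pts Y"
      and x: "x \<in> pts X"
  shows "tensor_map Y f (tens X m x) = tens Y m (f x)"
proof -
  have eq: "tens Y n (f z) = tens Y m (f x)" if "(n, z) \<in> tens X m x" for n z
  proof -
    have "((m, x), (n, z)) \<in> glue_equiv X"
      using that by (auto simp: tens_def)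
    then have "(\<lambda>(m, x). tens Y m (f x)) (m, x) = (\<lambda>(m, x). tens Y m (f x)) (n, z)"
      by (rule glue_equiv_invariant) (auto simp: glue_def fT fL fR tens_glue[OF Y])
    then show ?thesis by simp
  qed
  have "(m, x) \<in> tens X m x"
    using x equiv_glue_equiv[of X] by (auto simp: tens_def copies_def equiv_def refl_on_def)
  moreover have "tensor_map Y f (tens X m x) = (\<Union>(n, z)\<in>tens X m x. tens Y n (f z))"
    by (auto simp: tensor_map_def tens_def)
  ultimately show ?thesis
    using eq by fast
qed

lemma gasket_tau_tens:
  assumes "x \<in> sierpinski"
  shows "gasket_tau (tens gasket m x) = contraction m x"
proof -
  have "contraction n z = contraction m x" if "(n, z) \<in> tens gasket m x" for n z
  proof -
    have "((m, x), (n, z)) \<in> glue_equiv gasket"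
      using that by (auto simp: tens_def)
    then have "(\<lambda>(m, x). contraction m x) (m, x) = (\<lambda>(m, x). contraction m x) (n, z)"
      by (rule glue_equiv_invariant) (auto simp: glue_def gasket_def)
    then show ?thesis by simp
  qed
  moreover have "(m, x) \<in> tens gasket m x"
    using assms equiv_glue_equiv[of gasket]
    by (auto simp: tens_def copies_def equiv_def refl_on_def gasket_def)
  ultimately have "(\<lambda>(m, x). contraction m x) ` tens gasket m x = {contraction m x}"
    by force
  then show ?thesis by (simp add: gasket_tau_def)
qed

section \<open>Explicit form of the quotient metric\<close>

fun tensor_formula :: "'a tri_space \<Rightarrow> idx \<times> 'a \<Rightarrow> idx \<times> 'a \<Rightarrow> real" where
  "tensor_formula X (Ma, x) (Ma, y) = dst X x y / 2"
| "tensor_formula X (Mb, x) (Mb, y) = dst X x y / 2"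
| "tensor_formula X (Mc, x) (Mc, y) = dst X x y / 2"
| "tensor_formula X (Ma, x) (Mb, y) =
     min (dst X x (ptL X) + dst X (ptT X) y) (dst X x (ptR X) + 1 + dst X (ptR X) y) / 2"
| "tensor_formula X (Ma, x) (Mc, y) =
     min (dst X x (ptR X) + dst X (ptT X) y) (dst X x (ptL X) + 1 + dst X (ptL X) y) / 2"
| "tensor_formula X (Mb, x) (Mc, y) =
     min (dst X x (ptR X) + dst X (ptL X) y) (dst X x (ptT X) + 1 + dst X (ptT X) y) / 2"
| "tensor_formula X (Mb, x) (Ma, y) =
     min (dst X y (ptL X) + dst X (ptT X) x) (dst X y (ptR X) + 1 + dst X (ptR X) x) / 2"
| "tensor_formula X (Mc, x) (Ma, y) =
     min (dst X y (ptR X) + dst X (ptT X) x) (dst X y (ptL X) + 1 + dst X (ptL X) x) / 2"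
| "tensor_formula X (Mc, x) (Mb, y) =
     min (dst X y (ptR X) + dst X (ptL X) x) (dst X y (ptT X) + 1 + dst X (ptT X) x) / 2"

context
  fixes X :: "'a tri_space"
  assumes X: "tri_metric X"
begin

private lemma metric: "Metric_space (pts X) (dst X)"
  using X by (simp add: tri_metric_def)

private lemma distinguished: "ptT X \<in> pts X" "ptL X \<in> pts X" "ptR X \<in> pts X"
  using X by (simp_all add: tri_metric_def)

private lemma dst_distinguished:
  "dst X (ptT X) (ptL X) = 1" "dst X (ptT X) (ptR X) = 1" "dst X (ptL X) (ptR X) = 1"
  "dst X (ptL X) (ptT X) = 1" "dst X (ptR X) (ptT X) = 1" "dst X (ptR X) (ptL X) = 1"
  using X Metric_space.commute[OF metric] by (auto simp: tri_metric_def)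

private lemma dst_le_1: "x \<in> pts X \<Longrightarrow> y \<in> pts X \<Longrightarrow> dst X x y \<le> 1"
  using X by (simp add: tri_metric_def)

private lemma dst_nonneg: "dst X x y \<ge> 0"
  by (rule Metric_space.nonneg[OF metric])

private lemma dst_commute: "dst X x y = dst X y x"
  by (rule Metric_space.commute[OF metric])

private lemma dst_triangle:
  "x \<in> pts X \<Longrightarrow> y \<in> pts X \<Longrightarrow> z \<in> pts X \<Longrightarrow> dst X x z \<le> dst X x y + dst X y z"
  by (rule Metric_space.triangle[OF metric])

private lemma dst_refl: "x \<in> pts X \<Longrightarrow> dst X x x = 0"
  using Metric_space.zero[OF metric] by blast

private lemma dst_eq_0: "x \<in> pts X \<Longrightarrow> y \<in> pts X \<Longrightarrow> dst X x y = 0 \<longleftrightarrow> x = y"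
  by (rule Metric_space.zero[OF metric])

private lemma formula_commute: "tensor_formula X p q = tensor_formula X q p"
proof -
  have "tensor_formula X (m, x) (n, y) = tensor_formula X (n, y) (m, x)" for m n x y
    using dst_commute[of x y] by (cases m; cases n) auto
  then show ?thesis by (cases p; cases q) simp
qed

private lemma formula_nonneg: "tensor_formula X p q \<ge> 0"
proof -
  have "0 \<le> dst X x y + 1 + dst X u v" for x y u v
    using dst_nonneg[of x y] dst_nonneg[of u v] by linarith
  then have "0 \<le> tensor_formula X (m, x) (n, y)" for m n x y
    by (cases m; cases n) (auto simp: dst_nonneg min_def)
  then show ?thesis by (cases p; cases q) simp
qed

private lemma formula_le_copies_dist:
  assumes "p \<in> copies X" "q \<in> copies X"
  shows "tensor_formula X p q \<le> copies_dist X p q"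
proof -
  have "dst X x u + dst X v y \<le> 2" if "x \<in> pts X" "y \<in> pts X" "u \<in> pts X" "v \<in> pts X" for x y u v
    using dst_le_1[of x u] dst_le_1[of v y] that by linarith
  then have *: "min (dst X x u + dst X v y) c \<le> 2"
    if "x \<in> pts X" "y \<in> pts X" "u \<in> pts X" "v \<in> pts X" for x y u v c
    using that by (meson min.coboundedI1)
  obtain m x n y where "p = (m, x)" "q = (n, y)" "x \<in> pts X" "y \<in> pts X"
    using assms by (auto simp: copies_def)
  then show ?thesis
    by (cases m; cases n) (auto simp: copies_dist_def intro!: * distinguished)
qed

private lemma formula_glue:
  assumes "p \<in> copies X" "(q, r) \<in> glue_equiv X"
  shows "tensor_formula X p q = tensor_formula X p r"
proof -
  obtain m x where p: "p = (m, x)" "x \<in> pts X"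
    using assms(1) by (auto simp: copies_def)
  note facts = dst_nonneg[of x "ptT X"] dst_nonneg[of x "ptL X"] dst_nonneg[of x "ptR X"]
    dst_le_1[OF p(2) distinguished(1)] dst_le_1[OF p(2) distinguished(2)]
    dst_le_1[OF p(2) distinguished(3)]
    dst_triangle[OF distinguished(1) p(2) distinguished(2)]
    dst_triangle[OF distinguished(1) p(2) distinguished(3)]
    dst_triangle[OF distinguished(2) p(2) distinguished(3)]
    dst_commute[of x "ptT X"] dst_commute[of x "ptL X"] dst_commute[of x "ptR X"]
  show ?thesis
    by (rule glue_equiv_invariant[OF assms(2), of "tensor_formula X p"], cases m)
      (use facts in \<open>auto simp: glue_def p(1) dst_distinguished dst_refl distinguished min_def\<close>)
qed

private lemma formula_triangle:
  assumes "p \<in> copies X" "q \<in> copies X" "r \<in> copies X"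
  shows "tensor_formula X p r \<le> tensor_formula X p q + tensor_formula X q r"
proof -
  obtain m x n y k z where p: "p = (m, x)" "q = (n, y)" "r = (k, z)"
    and x: "x \<in> pts X" and y: "y \<in> pts X" and z: "z \<in> pts X"
    using assms by (auto simp: copies_def)
  have D: "dst X u v \<le> dst X u y + dst X v y" "dst X u y \<le> dst X u v + dst X v y"
      "dst X v y \<le> dst X u y + dst X u v"
    if "u \<in> pts X" "v \<in> pts X" for u v
    using dst_triangle[of u y v] dst_triangle[of u v y] dst_triangle[of v u y] y that
    by (auto simp: dst_commute)
  note com = dst_commute[of x "ptT X"] dst_commute[of x "ptL X"] dst_commute[of x "ptR X"]
    dst_commute[of y "ptT X"] dst_commute[of y "ptL X"] dst_commute[of y "ptR X"]
    dst_commute[of z "ptT X"] dst_commute[of z "ptL X"] dst_commute[of z "ptR X"]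
    dst_commute[of y x] dst_commute[of z x] dst_commute[of z y]
  note le = dst_le_1[OF x z] dst_le_1[OF x distinguished(1)] dst_le_1[OF x distinguished(2)]
    dst_le_1[OF x distinguished(3)] dst_le_1[OF z distinguished(1)]
    dst_le_1[OF z distinguished(2)] dst_le_1[OF z distinguished(3)]
  note nn = dst_nonneg[of x "ptT X"] dst_nonneg[of x "ptL X"] dst_nonneg[of x "ptR X"]
    dst_nonneg[of y "ptT X"] dst_nonneg[of y "ptL X"] dst_nonneg[of y "ptR X"]
    dst_nonneg[of z "ptT X"] dst_nonneg[of z "ptL X"] dst_nonneg[of z "ptR X"]
    dst_nonneg[of x y] dst_nonneg[of y z]
  note yt = D(1)[OF distinguished(1) distinguished(2), unfolded dst_distinguished]
    D(1)[OF distinguished(1) distinguished(3), unfolded dst_distinguished]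
    D(1)[OF distinguished(2) distinguished(3), unfolded dst_distinguished]
  note xy = dst_triangle[OF x y distinguished(1)] dst_triangle[OF x y distinguished(2)]
    dst_triangle[OF x y distinguished(3)]
  note zy = dst_triangle[OF z y distinguished(1)] dst_triangle[OF z y distinguished(2)]
    dst_triangle[OF z y distinguished(3)]
  note xz = dst_triangle[OF x distinguished(1) z] dst_triangle[OF x distinguished(2) z]
    dst_triangle[OF x distinguished(3) z] dst_triangle[OF x y z]
  have half: "a / 2 \<le> b / 2 + c / 2 \<longleftrightarrow> a \<le> b + c" for a b c :: real
    by auto
  show ?thesis
    unfolding p
    by (cases m; cases n; cases k; simp only: tensor_formula.simps half com;
        insert le[unfolded com] nn[unfolded com] yt[unfolded com] xy[unfolded com]
          zy[unfolded com] xz[unfolded com]; smt (verit))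
qed

private lemma copies_dist_nonneg: "copies_dist X p q \<ge> 0"
  by (simp add: copies_dist_def dst_nonneg)

private lemma chain_lower:
  assumes "js \<noteq> []" "set js \<subseteq> copies X \<times> copies X"
    and "successively (\<lambda>j j'. (snd j, fst j') \<in> glue_equiv X) js"
  shows "tensor_formula X (fst (hd js)) (snd (last js)) \<le> (\<Sum>(p, q)\<leftarrow>js. copies_dist X p q)"
  using assms
proof (induction js rule: induct_list012)
  case (2 j)
  then show ?case using formula_le_copies_dist by (cases j) auto
next
  case (3 j j' js)
  have j: "fst j \<in> copies X" "snd j \<in> copies X" and j': "fst j' \<in> copies X"
    using 3(4) by auto
  have l: "snd (last (j' # js)) \<in> copies X"
    using 3(4) last_in_set[of "j' # js"] by auto
  have "tensor_formula X (fst j) (snd (last (j' # js)))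
      \<le> tensor_formula X (fst j) (snd j) + tensor_formula X (snd j) (snd (last (j' # js)))"
    using j l by (intro formula_triangle) auto
  also have "tensor_formula X (snd j) (snd (last (j' # js)))
      = tensor_formula X (fst j') (snd (last (j' # js)))"
    using formula_glue[OF l, of "snd j" "fst j'"] 3(5) by (simp add: formula_commute)
  also have "tensor_formula X (fst j) (snd j) \<le> copies_dist X (fst j) (snd j)"
    using j by (intro formula_le_copies_dist)
  also have "tensor_formula X (fst j') (snd (last (j' # js)))
      \<le> (\<Sum>(p, q)\<leftarrow>j' # js. copies_dist X p q)"
    using 3 by auto
  finally show ?case by (simp add: case_prod_unfold)
qed auto

private lemma formula_attained:
  assumes x: "x \<in> pts X" and y: "y \<in> pts X"
  shows "\<exists>js. quot_chain (copies X) (glue_equiv X) (tens X m x) (tens X n y) js \<and>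
    tensor_formula X (m, x) (n, y) = (\<Sum>(p, q)\<leftarrow>js. copies_dist X p q)"
proof -
  define P where "P m n r \<longleftrightarrow>
    (\<exists>js. quot_chain (copies X) (glue_equiv X) (tens X m x) (tens X n y) js \<and>
       r = (\<Sum>(p, q)\<leftarrow>js. copies_dist X p q))" for m n r
  have refl: "(p, p) \<in> glue_equiv X" if "p \<in> copies X" for p
    using equiv_glue_equiv[of X] that by (auto simp: equiv_def refl_on_def)
  have ends: "(m, x) \<in> tens X m x" "(n, y) \<in> tens X n y" for m n
    using x y by (auto simp: tens_def copies_def intro!: refl)
  note g = tens_glue[OF distinguished] tens_glue[OF distinguished, symmetric]
  have gl: "((Mb, ptT X), (Ma, ptL X)) \<in> glue_equiv X" "((Ma, ptL X), (Mb, ptT X)) \<in> glue_equiv X"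
    "((Ma, ptR X), (Mc, ptT X)) \<in> glue_equiv X" "((Mc, ptT X), (Ma, ptR X)) \<in> glue_equiv X"
    "((Mc, ptL X), (Mb, ptR X)) \<in> glue_equiv X" "((Mb, ptR X), (Mc, ptL X)) \<in> glue_equiv X"
    using g by (simp_all only: tens_eq_iff[symmetric] distinguished)
  have one: "P m m (dst X x y / 2)" for m
    unfolding P_def using x y ends
    by (intro exI[of _ "[((m, x), (m, y))]"])
      (auto simp: quot_chain_def copies_dist_def copies_def)
  have two: "P m n ((dst X x u + dst X v y) / 2)"
    if "((m, u), (n, v)) \<in> glue_equiv X" for m n u v
    unfolding P_def using that x y ends
    by (intro exI[of _ "[((m, x), (m, u)), ((n, v), (n, y))]"])
      (auto simp: quot_chain_def copies_dist_def copies_def glue_equiv_def field_simps)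
  have three: "P m n ((dst X x u + 1 + dst X v y) / 2)"
    if "((m, u), (k, u')) \<in> glue_equiv X" "((k, v'), (n, v)) \<in> glue_equiv X" "dst X u' v' = 1"
    for m n k u v u' v'
    unfolding P_def using that x y ends
    by (intro exI[of _ "[((m, x), (m, u)), ((k, u'), (k, v')), ((n, v), (n, y))]"])
      (auto simp: quot_chain_def copies_dist_def copies_def glue_equiv_def field_simps)
  have min: "P m n (min r s / 2)" if "P m n (r / 2)" "P m n (s / 2)" for m n r s
    using that by (simp add: min_def)
  have c: "dst X y u + dst X v x = dst X x v + dst X u y"
    "dst X y u + 1 + dst X v x = dst X x v + 1 + dst X u y" for u v
    using dst_commute[of y u] dst_commute[of v x] by auto
  have "P m n (tensor_formula X (m, x) (n, y))"
    by (cases m; cases n; simp only: tensor_formula.simps c)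
      (rule one | rule min[OF two three], (rule gl)+, (rule dst_distinguished)+)+
  then show ?thesis by (simp add: P_def)
qed

theorem tensor_dst:
  assumes x: "x \<in> pts X" and y: "y \<in> pts X"
  shows "dst (tensor X) (tens X m x) (tens X n y) = tensor_formula X (m, x) (n, y)"
proof -
  let ?A = "{(\<Sum>(p, q)\<leftarrow>js. copies_dist X p q) | js.
    quot_chain (copies X) (glue_equiv X) (tens X m x) (tens X n y) js}"
  have "tensor_formula X (m, x) (n, y) \<le> (\<Sum>(p, q)\<leftarrow>js. copies_dist X p q)"
    if js: "quot_chain (copies X) (glue_equiv X) (tens X m x) (tens X n y) js" for js
  proof -
    have "js \<noteq> []" "set js \<subseteq> copies X \<times> copies X"
      using js by (auto simp: quot_chain_def)
    then have c: "fst (hd js) \<in> copies X" "snd (last js) \<in> copies X"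
      using hd_in_set[of js] last_in_set[of js] by (metis mem_Times_iff subsetD)+
    have e: "((m, x), fst (hd js)) \<in> glue_equiv X" "((n, y), snd (last js)) \<in> glue_equiv X"
      using js by (auto simp: quot_chain_def tens_def)
    have "tensor_formula X (m, x) (n, y) = tensor_formula X (m, x) (snd (last js))"
      using formula_glue[OF _ e(2)] x by (simp add: copies_def)
    also have "\<dots> = tensor_formula X (fst (hd js)) (snd (last js))"
      using formula_glue[OF c(2) e(1)] by (simp add: formula_commute)
    also have "\<dots> \<le> (\<Sum>(p, q)\<leftarrow>js. copies_dist X p q)"
      using js by (intro chain_lower) (auto simp: quot_chain_def)
    finally show ?thesis .
  qed
  moreover have "tensor_formula X (m, x) (n, y) \<in> ?A"
    using formula_attained[OF x y, of m n] by blast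
  ultimately have "Inf ?A = tensor_formula X (m, x) (n, y)"
    by (intro cInf_eq_minimum) auto
  then show ?thesis
    using tens_in_tensor[OF x, of m] tens_in_tensor[OF y, of n]
    by (simp add: tensor_def quot_dist_def)
qed

private lemma formula_eq_0:
  assumes x: "x \<in> pts X" and y: "y \<in> pts X" and 0: "tensor_formula X (m, x) (n, y) = 0"
  shows "tens X m x = tens X n y"
proof -
  note g = tens_glue[OF distinguished]
  have pos: "dst X u v + 1 + dst X v' w > 0" for u v v' w
    using dst_nonneg[of u v] dst_nonneg[of v' w] by linarith
  have eq: "u = v \<and> v' = w"
    if "min (dst X u v + dst X v' w) (dst X u s + 1 + dst X s' t) = 0"
       "u \<in> pts X" "v \<in> pts X" "v' \<in> pts X" "w \<in> pts X" for u v v' w s s' t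
  proof -
    have "dst X u v + dst X v' w = 0"
      using that(1) pos[of u s s' t] by (auto simp: min_def split: if_splits)
    then have "dst X u v = 0 \<and> dst X v' w = 0"
      using dst_nonneg[of u v] dst_nonneg[of v' w] by linarith
    then show ?thesis using that by (simp add: dst_eq_0)
  qed
  show ?thesis
  proof (cases "m = n")
    case True
    then have "dst X x y / 2 = 0"
      using 0 by (cases m) auto
    then show ?thesis
      using True x y by (simp add: dst_eq_0)
  next
    case False
    have "x = ptL X \<and> ptT X = y" if "m = Ma" "n = Mb"
      using 0 that eq[of x "ptL X" "ptT X" y "ptR X" "ptR X" y] x y distinguished by simp
    moreover have "y = ptL X \<and> ptT X = x" if "n = Ma" "m = Mb"
      using 0 that eq[of y "ptL X" "ptT X" x "ptR X" "ptR X" x] x y distinguished by simp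
    moreover have "x = ptR X \<and> ptT X = y" if "m = Ma" "n = Mc"
      using 0 that eq[of x "ptR X" "ptT X" y "ptL X" "ptL X" y] x y distinguished by simp
    moreover have "y = ptR X \<and> ptT X = x" if "n = Ma" "m = Mc"
      using 0 that eq[of y "ptR X" "ptT X" x "ptL X" "ptL X" x] x y distinguished by simp
    moreover have "x = ptR X \<and> ptL X = y" if "m = Mb" "n = Mc"
      using 0 that eq[of x "ptR X" "ptL X" y "ptT X" "ptT X" y] x y distinguished by simp
    moreover have "y = ptR X \<and> ptL X = x" if "n = Mb" "m = Mc"
      using 0 that eq[of y "ptR X" "ptL X" x "ptT X" "ptT X" x] x y distinguished by simp
    ultimately show ?thesis
      using False by (cases m; cases n) (metis g)+
  qed
qed

theorem tri_metric_tensor: "tri_metric (tensor X)"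
proof -
  let ?d = "dst (tensor X)"
  have comm: "?d P Q = ?d Q P" for P Q
  proof (cases "P \<in> pts (tensor X) \<and> Q \<in> pts (tensor X)")
    case True
    then show ?thesis
      by (metis tensor_cases tensor_dst formula_commute)
  qed (auto simp: tensor_def quot_dist_def)
  have nonneg: "0 \<le> ?d P Q" for P Q
  proof (cases "P \<in> pts (tensor X) \<and> Q \<in> pts (tensor X)")
    case True
    then show ?thesis
      by (metis tensor_cases tensor_dst formula_nonneg)
  qed (auto simp: tensor_def quot_dist_def)
  have "Metric_space (pts (tensor X)) ?d"
  proof
    fix P Q assume "P \<in> pts (tensor X)" "Q \<in> pts (tensor X)"
    then obtain m x n y where *: "x \<in> pts X" "P = tens X m x" "y \<in> pts X" "Q = tens X n y"
      by (metis tensor_cases)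
    have "tensor_formula X (m, x) (m, x) = 0"
      using * by (cases m) (auto simp: dst_refl)
    then show "?d P Q = 0 \<longleftrightarrow> P = Q"
      using * formula_eq_0[of x y m n] tensor_dst[of x y m n] tensor_dst[of x x m m] by metis
  next
    fix P Q R assume "P \<in> pts (tensor X)" "Q \<in> pts (tensor X)" "R \<in> pts (tensor X)"
    then obtain m x n y k z where *: "x \<in> pts X" "P = tens X m x" "y \<in> pts X" "Q = tens X n y"
        "z \<in> pts X" "R = tens X k z"
      by (metis tensor_cases)
    then show "?d P R \<le> ?d P Q + ?d Q R"
      by (simp add: tensor_dst formula_triangle copies_def)
  qed (rule nonneg comm)+
  moreover have "?d P Q \<le> 1" if "P \<in> pts (tensor X)" "Q \<in> pts (tensor X)" for P Q
  proof -
    obtain m x n y where *: "x \<in> pts X" "P = tens X m x" "y \<in> pts X" "Q = tens X n y"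
      using \<open>P \<in> _\<close> \<open>Q \<in> _\<close> by (metis tensor_cases)
    have "copies_dist X (m, x) (n, y) \<le> 1"
      using dst_le_1[of x y] * by (simp add: copies_dist_def)
    then show ?thesis
      using formula_le_copies_dist[of "(m, x)" "(n, y)"] * by (simp add: tensor_dst copies_def)
  qed
  moreover have "ptT (tensor X) = tens X Ma (ptT X)" "ptL (tensor X) = tens X Mb (ptL X)"
    "ptR (tensor X) = tens X Mc (ptR X)"
    by (simp_all add: tensor_def)
  ultimately show ?thesis
    unfolding tri_metric_def
    by (simp add: tens_in_tensor distinguished tensor_dst dst_distinguished)
qed

end

end

(* A point-preserving map f from X to the gasket is a coalgebra morphism iff f x = \<sigma>_m (f y) whenever
   e x = m \<otimes> y. As each \<sigma>_m halves distances, two solutions agree, and the iterates of f \<mapsto> \<tau> (M \<otimes> f) e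
   from any bounded continuous map into the plane that preserves the distinguished points converge
   uniformly, hence to a continuous solution. Its image A is bounded with A \<subseteq> \<Union>m. \<sigma>_m A, which forces
   A into the attractor. The map \<sigma> is continuous since it is an isometry on each of the three closed
   pieces of the gasket. *)

theory Submission
  imports Defs "HOL-Real_Asymp.Real_Asymp"
begin

section \<open>The contractions\<close>

fun vertex :: "idx \<Rightarrow> real \<times> real" where
  "vertex Ma = (1 / 2, sqrt 3 / 2)"
| "vertex Mb = (0, 0)"
| "vertex Mc = (1, 0)"

text \<open>The contraction of index m is the homothety of ratio 1/2 about \<open>vertex m\<close>:
  p goes to the midpoint of p and that vertex. This form lets later arguments treat the three
  indices alike.\<close>

lemma contraction_eq: "contraction m p = (1 / 2) *\<^sub>R p + (1 / 2) *\<^sub>R vertex m"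
  by (cases m; cases p) auto

lemma contraction_vertex [simp]: "contraction m (vertex m) = vertex m"
  by (cases m) auto

lemma dist_contraction: "dist (contraction m p) (contraction m q) = dist p q / 2"
  by (simp add: contraction_eq dist_norm flip: scaleR_diff_right)

lemma inj_contraction: "inj (contraction m)"
  by (rule injI) (simp add: contraction_eq)

lemma continuous_on_contraction: "continuous_on A (contraction m)"
proof -
  have "contraction m = (\<lambda>p. (1 / 2) *\<^sub>R p + (1 / 2) *\<^sub>R vertex m)"
    by (rule ext) (rule contraction_eq)
  then show ?thesis
    by (auto intro!: continuous_intros)
qed

lemma dist_vertex: "m \<noteq> n \<Longrightarrow> dist (vertex m) (vertex n) = 1"
  by (cases m; cases n) (auto simp: dist_Pair_Pair dist_real_def power_divide)

declare vertex.simps [simp del]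

lemma norm_vertex_le: "norm (vertex m) \<le> 1"
proof -
  have Mb: "vertex Mb = 0"
    by (simp add: vertex.simps zero_prod_def)
  then show ?thesis
    using dist_vertex[of m Mb] by (cases "m = Mb") auto
qed

section \<open>The gasket\<close>

definition hutchinson :: "(real \<times> real) set \<Rightarrow> (real \<times> real) set" where
  "hutchinson A = (\<Union>m. contraction m ` A)"

lemma UNIV_idx: "UNIV = {Ma, Mb, Mc}"
  using idx.exhaust by auto

lemma hutchinson_eq:
  "hutchinson A = contraction Ma ` A \<union> contraction Mb ` A \<union> contraction Mc ` A"
  unfolding hutchinson_def UNIV_idx by auto

lemma hutchinson_mono: "A \<subseteq> B \<Longrightarrow> hutchinson A \<subseteq> hutchinson B"
  by (auto simp: hutchinson_def)

lemma vertex_hutchinson: "vertex m \<in> hutchinson {vertex m}"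
  unfolding hutchinson_def by (intro UN_I[of m] image_eqI[of _ _ "vertex m"]) simp_all

lemma compact_hutchinson: "compact A \<Longrightarrow> compact (hutchinson A)"
  unfolding hutchinson_eq
  by (intro compact_Un compact_continuous_image continuous_on_contraction)

text \<open>The distance to \<open>K\<close> is halved along \<open>A \<subseteq> hutchinson A\<close>, so it vanishes on \<open>A\<close>.\<close>

lemma subset_attractor:
  assumes A: "bounded A" "A \<subseteq> hutchinson A"
    and K: "compact K" "K \<noteq> {}" "hutchinson K \<subseteq> K"
  shows "A \<subseteq> K"
proof
  fix x assume "x \<in> A"
  obtain k0 where k0: "k0 \<in> K" using K by blast
  obtain D where D: "\<And>x. x \<in> A \<Longrightarrow> dist x k0 \<le> D"
    using A(1) bounded_any_center[of A k0] by (auto simp: dist_commute)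
  have near: "x \<in> A \<Longrightarrow> \<exists>k\<in>K. dist x k \<le> D / 2 ^ n" for n x
  proof (induction n arbitrary: x)
    case 0
    then show ?case using D[of x] k0 by (intro bexI[of _ k0]) simp_all
  next
    case (Suc n)
    obtain m y where y: "y \<in> A" "x = contraction m y"
      using Suc.prems A(2) by (auto simp: hutchinson_def)
    obtain k where "k \<in> K" "dist y k \<le> D / 2 ^ n"
      using Suc.IH[OF y(1)] by blast
    moreover from this have "contraction m k \<in> K"
      using K(3) by (auto simp: hutchinson_def)
    ultimately show ?case
      by (intro bexI[of _ "contraction m k"]) (auto simp: y dist_contraction)
  qed
  have "\<exists>k\<in>K. dist k x < \<epsilon>" if "\<epsilon> > 0" for \<epsilon>
  proof -
    have "(\<lambda>n. D / 2 ^ n) \<longlonglongrightarrow> 0"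
      by real_asymp
    then have "\<forall>\<^sub>F n in sequentially. D / 2 ^ n < \<epsilon>"
      using that by (rule order_tendstoD)
    then obtain n where "D / 2 ^ n < \<epsilon>"
      by (auto simp: eventually_sequentially)
    then show ?thesis
      using near[OF \<open>x \<in> A\<close>, of n] by (force simp: dist_commute)
  qed
  then show "x \<in> K"
    using compact_imp_closed[OF K(1)] closed_approachable by blast
qed

section \<open>The triangle spanned by the vertices\<close>

definition triangle :: "(real \<times> real) set" where
  "triangle = convex hull (range vertex)"

lemma range_vertex: "range vertex = {vertex Ma, vertex Mb, vertex Mc}"
  by (simp only: UNIV_idx image_insert image_empty)

text \<open>Here u, v, w are the barycentric weights of the top, left and right vertices.\<close>

lemma triangleE:
  assumes "p \<in> triangle"
  obtains u v w where "u \<ge> 0" "v \<ge> 0" "w \<ge> 0" "u + v + w = 1"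
    "p = (u / 2 + w, u * (sqrt 3 / 2))"
proof -
  obtain u v w where "u \<ge> 0" "v \<ge> 0" "w \<ge> 0" "u + v + w = 1"
    and "p = u *\<^sub>R vertex Ma + v *\<^sub>R vertex Mb + w *\<^sub>R vertex Mc"
    using assms unfolding triangle_def range_vertex convex_hull_3 by blast
  then show thesis
    by (intro that[of u v w]) (simp_all add: vertex.simps)
qed

lemma vertex_in_triangle: "vertex m \<in> triangle"
  by (simp add: triangle_def hull_inc)

lemma compact_triangle: "compact triangle"
  unfolding triangle_def range_vertex by (intro finite_imp_compact_convex_hull) auto

text \<open>Every image is the midpoint of p and a vertex, and the triangle is convex.\<close>

lemma hutchinson_triangle: "hutchinson triangle \<subseteq> triangle"
proof -
  have "contraction m p \<in> triangle" if "p \<in> triangle" for m p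
    unfolding contraction_eq using that vertex_in_triangle[of m]
    by (intro convexD) (auto simp: triangle_def)
  then show ?thesis by (auto simp: hutchinson_def)
qed

text \<open>Distances in the convex hull of a finite set are bounded by the distance of some pair of
  spanning points. This yields the bound 1 for the gasket and starts the estimate behind
  uniqueness.\<close>

lemma dist_triangle_le:
  assumes "p \<in> triangle" "q \<in> triangle"
  shows "dist p q \<le> 1"
proof -
  have "finite (range vertex)" by (simp add: range_vertex)
  from simplex_extremal_le_exists[OF this] assms
  obtain m n where "dist p q \<le> dist (vertex m) (vertex n)"
    unfolding triangle_def dist_norm by blast
  also have "\<dots> \<le> 1"
    by (cases "m = n") (simp_all add: dist_vertex)
  finally show ?thesis .
qed

section \<open>Existence and uniqueness of the attractor\<close>

lemma sierpinski_props:
  "sierpinski \<noteq> {} \<and> compact sierpinski \<and>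
   sierpinski = contraction Ma ` sierpinski \<union> contraction Mb ` sierpinski \<union> contraction Mc ` sierpinski"
  unfolding sierpinski_def
proof (rule theI2)
  \<comment> \<open>As in the Knaster-Tarski theorem, the attractor is the largest bounded set
    contained in its own image. All such sets lie in \<open>triangle\<close>, so their union is
    bounded too.\<close>
  define K where "K = \<Union>{A. bounded A \<and> A \<subseteq> hutchinson A}"
  have sub: "A \<subseteq> K" if "bounded A" "A \<subseteq> hutchinson A" for A
    using that by (auto simp: K_def)
  have tri: "K \<subseteq> triangle"
    using subset_attractor[OF _ _ compact_triangle _ hutchinson_triangle] vertex_in_triangle
    unfolding K_def by blast
  have bd: "bounded K"
    using tri compact_triangle compact_imp_bounded bounded_subset by blast
  have post: "K \<subseteq> hutchinson K"
  proof
    fix x assume "x \<in> K"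
    then obtain A where "x \<in> A" "bounded A" "A \<subseteq> hutchinson A" by (auto simp: K_def)
    then show "x \<in> hutchinson K" using hutchinson_mono[OF sub] by blast
  qed
  have cl: "compact (closure K)"
    using bd by simp
  \<comment> \<open>The image of the compact closure is closed and contains K, so the closure is
    again contained in its own image. Maximality of K then makes K closed.\<close>
  have "closure K \<subseteq> hutchinson (closure K)"
    using post hutchinson_mono[OF closure_subset, of K] compact_hutchinson[OF cl]
    by (intro closure_minimal compact_imp_closed) auto
  then have "closure K = K"
    using sub[of "closure K"] bd closure_subset[of K] by auto
  with cl have comp: "compact K" by simp
  \<comment> \<open>By monotonicity the image of K is contained in its own image, and it is bounded,
    so maximality applies once more.\<close>
  have "hutchinson K \<subseteq> K"
    using compact_imp_bounded[OF compact_hutchinson[OF comp]] hutchinson_mono[OF post] sub by blast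
  with post have eq: "K = hutchinson K" by blast
  have "{vertex Ma} \<subseteq> K"
    by (rule sub) (simp_all add: vertex_hutchinson)
  then show *: "K \<noteq> {} \<and> compact K \<and>
     K = contraction Ma ` K \<union> contraction Mb ` K \<union> contraction Mc ` K"
    using comp eq unfolding hutchinson_eq[symmetric] by blast
  fix K' assume "K' \<noteq> {} \<and> compact K' \<and>
     K' = contraction Ma ` K' \<union> contraction Mb ` K' \<union> contraction Mc ` K'"
  then have K': "K' \<noteq> {}" "compact K'" "K' = hutchinson K'"
    unfolding hutchinson_eq by blast+
  show "K' = K"
  proof (rule subset_antisym)
    show "K' \<subseteq> K"
      using sub[OF compact_imp_bounded[OF K'(2)]] K'(3) by blast
    show "K \<subseteq> K'"
      using subset_attractor[OF bd post K'(2,1)] K'(3) by blast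
  qed
qed

lemma compact_sierpinski: "compact sierpinski"
  and sierpinski_nonempty: "sierpinski \<noteq> {}"
  and hutchinson_sierpinski: "hutchinson sierpinski = sierpinski"
  using sierpinski_props unfolding hutchinson_eq by blast+

lemma contraction_sierpinski: "p \<in> sierpinski \<Longrightarrow> contraction m p \<in> sierpinski"
  by (subst hutchinson_sierpinski[symmetric]) (auto simp: hutchinson_def)

lemma sierpinski_cases:
  assumes "p \<in> sierpinski"
  obtains m q where "q \<in> sierpinski" "p = contraction m q"
proof -
  have "p \<in> hutchinson sierpinski"
    using assms by (simp only: hutchinson_sierpinski)
  then show thesis
    using that by (auto simp: hutchinson_def)
qed

text \<open>Maximality of the gasket. It is used to show that a solution with values in the plane
  takes its values in the gasket.\<close>

lemma subset_sierpinski: "bounded A \<Longrightarrow> A \<subseteq> hutchinson A \<Longrightarrow> A \<subseteq> sierpinski"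
  by (rule subset_attractor)
    (simp_all add: compact_sierpinski sierpinski_nonempty hutchinson_sierpinski)

lemma vertex_in_sierpinski: "vertex m \<in> sierpinski"
  using subset_sierpinski[of "{vertex m}"] vertex_hutchinson[of m] by simp

lemma sierpinski_subset_triangle: "sierpinski \<subseteq> triangle"
proof (rule subset_attractor[OF _ _ compact_triangle _ hutchinson_triangle])
  show "bounded sierpinski"
    by (rule compact_imp_bounded[OF compact_sierpinski])
  show "triangle \<noteq> {}"
    using vertex_in_triangle by blast
qed (simp add: hutchinson_sierpinski)

section \<open>Gluing along corners\<close>

text \<open>With this indexing the gluing relation reads \<open>(m, corner X n) \<sim> (n, corner X m)\<close>.\<close>

fun corner :: "'a tri_space \<Rightarrow> idx \<Rightarrow> 'a" where
  "corner X Ma = ptT X"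
| "corner X Mb = ptL X"
| "corner X Mc = ptR X"

lemma all_idx: "(\<forall>m. P m) \<longleftrightarrow> P Ma \<and> P Mb \<and> P Mc"
  using idx.exhaust by (metis (full_types))

text \<open>The definition lists three pairs of distinguished points; symmetry supplies the opposite
  ordered pairs.\<close>

lemma tri_metric_iff:
  "tri_metric X \<longleftrightarrow> Metric_space (pts X) (dst X) \<and>
     (\<forall>x\<in>pts X. \<forall>y\<in>pts X. dst X x y \<le> 1) \<and>
     (\<forall>m. corner X m \<in> pts X) \<and> (\<forall>m n. m \<noteq> n \<longrightarrow> dst X (corner X m) (corner X n) = 1)"
proof -
  have "?thesis" if "Metric_space (pts X) (dst X)"
  proof -
    have "dst X (ptL X) (ptT X) = dst X (ptT X) (ptL X)"
      "dst X (ptR X) (ptT X) = dst X (ptT X) (ptR X)" "dst X (ptR X) (ptL X) = dst X (ptL X) (ptR X)"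
      by (rule Metric_space.commute[OF that])+
    then show ?thesis
      unfolding tri_metric_def all_idx corner.simps by simp blast
  qed
  then show ?thesis
    unfolding tri_metric_def by blast
qed

lemma tri_morphism_iff:
  "tri_morphism X Y f \<longleftrightarrow>
     continuous_map (tri_top X) (tri_top Y) f \<and> (\<forall>m. f (corner X m) = corner Y m)"
  by (simp add: tri_morphism_def all_idx)

lemma corner_tensor: "corner (tensor X) m = tens X m (corner X m)"
  by (cases m) (auto simp: tensor_def)

text \<open>Reduces invariance under gluing to one identity that is symmetric in m and n.\<close>

lemma glue_corner: "(p, q) \<in> glue X \<Longrightarrow> \<exists>m n. p = (m, corner X n) \<and> q = (n, corner X m)"
proof -
  assume "(p, q) \<in> glue X"
  then have "(p = (Mb, corner X Ma) \<and> q = (Ma, corner X Mb)) \<or>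
      (p = (Ma, corner X Mc) \<and> q = (Mc, corner X Ma)) \<or>
      (p = (Mc, corner X Mb) \<and> q = (Mb, corner X Mc))"
    by (simp add: glue_def)
  then show ?thesis by blast
qed

lemma tens_corner:
  assumes "tri_metric X"
  shows "tens X m (corner X n) = tens X n (corner X m)"
proof -
  have "ptT X \<in> pts X" "ptL X \<in> pts X" "ptR X \<in> pts X"
    using assms by (simp_all add: tri_metric_def)
  from tens_glue[OF this] show ?thesis
    by (cases m; cases n) simp_all
qed

lemma corner_gasket [simp]: "corner gasket m = vertex m"
  by (cases m) (simp_all add: gasket_def vertex.simps)

lemma pts_gasket [simp]: "pts gasket = sierpinski"
  and dst_gasket [simp]: "dst gasket = dist"
  by (simp_all add: gasket_def)

lemma tri_metric_gasket: "tri_metric gasket"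
proof -
  have "\<forall>p\<in>sierpinski. \<forall>q\<in>sierpinski. dist p q \<le> 1"
    using dist_triangle_le sierpinski_subset_triangle by blast
  moreover have "Metric_space sierpinski dist"
    by (rule Met_TC.subspace) simp
  ultimately show ?thesis
    unfolding tri_metric_iff pts_gasket dst_gasket corner_gasket
    using vertex_in_sierpinski dist_vertex by blast
qed

section \<open>Small distances and continuity\<close>

lemma dst_tens_same:
  assumes "tri_metric X" "x \<in> pts X" "y \<in> pts X"
  shows "dst (tensor X) (tens X m x) (tens X m y) = dst X x y / 2"
  using assms by (cases m) (auto simp: tensor_dst)

text \<open>A chain through the third copy crosses it from corner to corner at cost 1/2, so below
  1/2 only the direct chain counts. Close points in different copies are therefore both close to the
  junction of these copies.\<close>

lemma dst_tens_less:
  assumes X: "tri_metric X" and x: "x \<in> pts X" and y: "y \<in> pts X" and "m \<noteq> n"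
    and less: "dst (tensor X) (tens X m x) (tens X n y) < \<delta>" and "\<delta> \<le> 1 / 2"
  shows "dst X x (corner X n) + dst X (corner X m) y < 2 * \<delta>"
proof -
  interpret Metric_space "pts X" "dst X"
    using X by (simp add: tri_metric_def)
  have "dst X u v + 1 + dst X v' w \<ge> 2 * \<delta>" for u v v' w
    using \<open>\<delta> \<le> 1 / 2\<close> nonneg[of u v] nonneg[of v' w] by linarith
  then have *: "min a (dst X u v + 1 + dst X v' w) / 2 < \<delta> \<longleftrightarrow> a < 2 * \<delta>" for a u v v' w
    by (smt (verit) field_sum_of_halves)
  show ?thesis
    using less \<open>m \<noteq> n\<close> unfolding tensor_dst[OF X x y]
    by (cases m; cases n; simp only: tensor_formula.simps corner.simps *)
      (simp_all add: commute add.commute)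
qed

lemma tri_top_continuous_iff:
  assumes "tri_metric X" "tri_metric Y"
  shows "continuous_map (tri_top X) (tri_top Y) f \<longleftrightarrow>
    f ` pts X \<subseteq> pts Y \<and>
    (\<forall>x\<in>pts X. \<forall>\<epsilon>>0. \<exists>\<delta>>0. \<forall>y\<in>pts X. dst X x y < \<delta> \<longrightarrow> dst Y (f x) (f y) < \<epsilon>)"
  using assms unfolding tri_top_def tri_metric_def
  by (subst Metric_space.metric_continuous_map) (auto simp: Ball_def imp_conjL)

lemma euclidean_continuous_iff:
  fixes f :: "'a \<Rightarrow> 'b :: metric_space"
  assumes "tri_metric X"
  shows "continuous_map (tri_top X) euclidean f \<longleftrightarrow>
    (\<forall>x\<in>pts X. \<forall>\<epsilon>>0. \<exists>\<delta>>0. \<forall>y\<in>pts X. dst X x y < \<delta> \<longrightarrow> dist (f x) (f y) < \<epsilon>)"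
  using assms unfolding tri_top_def tri_metric_def mtopology_is_euclidean[symmetric]
  by (subst Metric_space.metric_continuous_map[OF _ Met_TC.Metric_space_axioms])
    (auto simp: Ball_def imp_conjL)

lemma topspace_tri_top [simp]: "tri_metric X \<Longrightarrow> topspace (tri_top X) = pts X"
  by (simp add: tri_top_def tri_metric_def Metric_space.topspace_mtopology)

lemma tri_top_gasket: "tri_top gasket = subtopology euclidean sierpinski"
proof -
  interpret Submetric UNIV dist sierpinski
    by unfold_locales auto
  show ?thesis
    using mtopology_submetric by (simp add: tri_top_def)
qed

text \<open>Continuity is checked copy by copy; the least of the three \<delta> serves all
  copies.\<close>

lemma uniform_over_copies:
  assumes "\<And>n :: idx. \<exists>\<delta>>0. \<forall>y. d n y < (\<delta> :: real) \<longrightarrow> P n y"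
  obtains \<delta> where "\<delta> > 0" "\<And>n y. d n y < \<delta> \<Longrightarrow> P n y"
proof -
  obtain \<delta> where \<delta>: "\<And>n. \<delta> n > 0" "\<And>n y. d n y < \<delta> n \<Longrightarrow> P n y"
    using assms by metis
  show thesis
  proof
    show "min (\<delta> Ma) (min (\<delta> Mb) (\<delta> Mc)) > 0"
      using \<delta>(1) by simp
    show "P n y" if "d n y < min (\<delta> Ma) (min (\<delta> Mb) (\<delta> Mc))" for n y
      using that \<delta>(2) by (cases n) auto
  qed
qed

section \<open>The coalgebra structure of the gasket\<close>

text \<open>Two of the three half-size triangles meet only in the midpoint of a side. Comparing
  barycentric weights settles three ordered pairs of indices; exchanging p and q gives the
  others.\<close>

lemma contraction_overlap:
  assumes p: "p \<in> triangle" and q: "q \<in> triangle"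
    and eq: "contraction m p = contraction n q" and "m \<noteq> n"
  shows "p = vertex n \<and> q = vertex m"
proof -
  have *: "p = vertex n \<and> q = vertex m"
    if p: "p \<in> triangle" and q: "q \<in> triangle" and eq: "contraction m p = contraction n q"
      and mn: "(m, n) \<in> {(Ma, Mb), (Ma, Mc), (Mb, Mc)}" for p q m n
  proof -
    obtain u v w where u: "u \<ge> 0" "v \<ge> 0" "w \<ge> 0" "u + v + w = 1"
      "p = (u / 2 + w, u * (sqrt 3 / 2))" using triangleE[OF p] .
    obtain u' v' w' where u': "u' \<ge> 0" "v' \<ge> 0" "w' \<ge> 0" "u' + v' + w' = 1"
      "q = (u' / 2 + w', u' * (sqrt 3 / 2))" using triangleE[OF q] .
    \<comment> \<open>Equality of heights between the top piece and a lower one. Since u' is at most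
      1, this forces u = 0 and u' = 1.\<close>
    have s: "u + 1 = u'" if "snd (contraction Ma p) = snd q / 2"
    proof -
      have "(u + 1) * sqrt 3 = u' * sqrt 3"
        using that by (simp add: u(5) u'(5) algebra_simps)
      then show ?thesis by simp
    qed
    consider "m = Ma" "n = Mb" | "m = Ma" "n = Mc" | "m = Mb" "n = Mc"
      using mn by auto
    then show ?thesis
    proof cases
      case 1
      then have "u + 1 = u'" using eq by (intro s) (simp add: u(5) u'(5))
      then have 0: "u = 0" "u' = 1" "w' = 0" using u u' by linarith+
      then have "w = 0" using eq 1 u(5) u'(5) by simp
      with 0 show ?thesis using 1 u(5) u'(5) by (simp add: vertex.simps)
    next
      case 2
      then have "u + 1 = u'" using eq by (intro s) (simp add: u(5) u'(5))
      then have 0: "u = 0" "u' = 1" "w' = 0" using u u' by linarith+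
      then have "w = 1" using eq 2 u(5) u'(5) by simp
      with 0 show ?thesis using 2 u(5) u'(5) by (simp add: vertex.simps)
    next
      case 3
      \<comment> \<open>Equality of first coordinates. The left side is at most 1 and the right side
        at least 1, so both are 1.\<close>
      then have "u / 2 + w = u' / 2 + w' + 1" using eq by (simp add: u(5) u'(5) field_simps)
      then have "u = 0" "w = 1" "u' = 0" "w' = 0" using u u' by linarith+
      then show ?thesis using 3 u u' by (simp add: vertex.simps)
    qed
  qed
  show ?thesis
    using *[OF p q eq] *[OF q p eq[symmetric]] \<open>m \<noteq> n\<close> by (cases m; cases n) auto
qed

text \<open>This amounts to injectivity of \<tau>: points of different pieces with the same image
  are the corners at which the pieces are glued, hence represent the same class.\<close>

lemma gasket_sigma_contraction:
  assumes p: "p \<in> sierpinski"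
  shows "gasket_sigma (contraction m p) = tens gasket m p"
proof -
  have "inj_on gasket_tau (pts (tensor gasket))"
  proof (rule inj_onI)
    fix P Q assume PQ: "P \<in> pts (tensor gasket)" "Q \<in> pts (tensor gasket)"
      and eq: "gasket_tau P = gasket_tau Q"
    obtain m p where P: "p \<in> sierpinski" "P = tens gasket m p"
      using PQ(1) by (metis tensor_cases pts_gasket)
    obtain n q where Q: "q \<in> sierpinski" "Q = tens gasket n q"
      using PQ(2) by (metis tensor_cases pts_gasket)
    have eq: "contraction m p = contraction n q"
      using eq P Q by (simp add: gasket_tau_tens)
    show "P = Q"
    proof (cases "m = n")
      case True
      then show ?thesis using eq P Q injD[OF inj_contraction] by metis
    next
      case False
      then have "p = vertex n \<and> q = vertex m"
        using contraction_overlap[OF _ _ eq] P Q sierpinski_subset_triangle by blast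
      then show ?thesis
        using P Q tens_corner[OF tri_metric_gasket, of m n] by simp
    qed
  qed
  then show ?thesis
    using inv_into_f_f[of gasket_tau "pts (tensor gasket)" "tens gasket m p"]
      tens_in_tensor[of p gasket m] p
    by (simp add: gasket_sigma_def gasket_tau_tens)
qed

lemma coalgebra_gasket: "coalgebra gasket gasket_sigma"
proof -
  have "gasket_sigma p \<in> pts (tensor gasket)" if "p \<in> sierpinski" for p
    using that tens_in_tensor[of _ gasket]
    by (metis sierpinski_cases gasket_sigma_contraction pts_gasket)
  moreover have "\<exists>\<delta>>0. \<forall>q\<in>sierpinski. dist p q < \<delta> \<longrightarrow>
      dst (tensor gasket) (gasket_sigma p) (gasket_sigma q) < \<epsilon>"
    if p: "p \<in> sierpinski" and \<epsilon>: "\<epsilon> > 0" for p \<epsilon>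
  proof -
    have "\<exists>\<delta>>0. \<forall>q'. dist p (contraction n q') < \<delta> \<longrightarrow>
      (q' \<in> sierpinski \<longrightarrow>
      dst (tensor gasket) (gasket_sigma p) (gasket_sigma (contraction n q')) < \<epsilon>)" for n
    proof (cases "p \<in> contraction n ` sierpinski")
      case True
      \<comment> \<open>A junction point lies in two pieces and has a representative in each, so the
        isometry of \<sigma> on piece n applies with \<delta> = \<epsilon>.\<close>
      then obtain p' where "p = contraction n p'" "p' \<in> sierpinski" by blast
      then show ?thesis
        using \<epsilon> by (auto simp: gasket_sigma_contraction dist_contraction
            dst_tens_same[OF tri_metric_gasket] intro!: exI[of _ \<epsilon>])
    next
      case False
      \<comment> \<open>A closed piece that misses p stays at positive distance from p, which makes
        the claim vacuous for small \<delta>.\<close>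
      have "closed (contraction n ` sierpinski)"
        by (intro compact_imp_closed compact_continuous_image continuous_on_contraction
            compact_sierpinski)
      then have "open (- contraction n ` sierpinski)" by auto
      then obtain \<delta> where "\<delta> > 0" "\<forall>q. dist q p < \<delta> \<longrightarrow> q \<in> - contraction n ` sierpinski"
        using False unfolding open_dist by blast
      then show ?thesis
        unfolding dist_commute[of p] by blast
    qed
    then obtain \<delta> where "\<delta> > 0" "\<And>n q'. dist p (contraction n q') < \<delta> \<Longrightarrow>
      (q' \<in> sierpinski \<longrightarrow>
      dst (tensor gasket) (gasket_sigma p) (gasket_sigma (contraction n q')) < \<epsilon>)"
      by (rule uniform_over_copies[where d = "\<lambda>n q. dist p (contraction n q)"]) blast
    then show ?thesis by (metis sierpinski_cases)
  qed
  moreover have "gasket_sigma (vertex m) = tens gasket m (vertex m)" for m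
    using gasket_sigma_contraction[OF vertex_in_sierpinski, of m m] by simp
  ultimately show ?thesis
    by (auto simp: coalgebra_def tri_morphism_iff tri_metric_gasket corner_tensor
        tri_top_continuous_iff tri_metric_tensor)
qed

section \<open>Maps out of a tensor product\<close>

text \<open>\<open>tensor_lift f\<close> is the map \<open>\<tau> \<circ> (M \<otimes> f)\<close>, for \<open>f\<close> with values in the plane.\<close>

definition tensor_lift :: "('a \<Rightarrow> real \<times> real) \<Rightarrow> (idx \<times> 'a) set \<Rightarrow> real \<times> real" where
  "tensor_lift f P = the_elem ((\<lambda>(m, x). contraction m (f x)) ` P)"

text \<open>Both sides are the midpoint of the two vertices: the gluing relation as seen in the
  plane.\<close>

lemma contraction_vertex_commute: "contraction m (vertex n) = contraction n (vertex m)"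
  by (simp add: contraction_eq)

text \<open>Glued points are sent to the same midpoint because f preserves corners, so the image of
  a class is a singleton.\<close>

lemma tensor_lift_tens:
  assumes f: "\<And>m. f (corner X m) = vertex m" and x: "x \<in> pts X"
  shows "tensor_lift f (tens X m x) = contraction m (f x)"
proof -
  have "(m, x) \<in> tens X m x"
    using x equiv_glue_equiv[of X] by (auto simp: tens_def copies_def equiv_def refl_on_def)
  then have "the_elem ((\<lambda>(m, x). contraction m (f x)) ` tens X m x) =
      (\<lambda>(m, x). contraction m (f x)) (m, x)"
  proof (intro the_elem_image_unique)
    fix p assume "p \<in> tens X m x"
    then have "((m, x), p) \<in> glue_equiv X"
      by (simp add: tens_def)
    then show "(\<lambda>(m, x). contraction m (f x)) p = (\<lambda>(m, x). contraction m (f x)) (m, x)"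
      by (rule glue_equiv_invariant[symmetric])
        (auto simp: f dest!: glue_corner intro: contraction_vertex_commute)
  qed blast
  then show ?thesis by (simp add: tensor_lift_def)
qed

text \<open>For a point of copy m, a \<delta> is found for each copy n, depending on whether n is m,
  the point is the junction with copy n, or neither.\<close>

lemma continuous_tensor_lift:
  assumes X: "tri_metric X" and f: "\<And>m. f (corner X m) = vertex m"
    and cont: "continuous_map (tri_top X) euclidean f"
  shows "continuous_map (tri_top (tensor X)) euclidean (tensor_lift f)"
  unfolding euclidean_continuous_iff[OF tri_metric_tensor[OF X]]
proof (intro ballI allI impI)
  fix P and \<epsilon> :: real assume "P \<in> pts (tensor X)" and \<epsilon>: "\<epsilon> > 0"
  then obtain m x where x: "x \<in> pts X" and P: "P = tens X m x"
    by (metis tensor_cases)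
  interpret Metric_space "pts X" "dst X"
    using X by (simp add: tri_metric_def)
  have corner: "corner X k \<in> pts X" for k
    using X by (simp add: tri_metric_iff)
  have cont': "\<exists>\<delta>>0. \<forall>y\<in>pts X. dst X u y < \<delta> \<longrightarrow> dist (f u) (f y) < \<epsilon>" if "u \<in> pts X" for u
    using cont that \<epsilon> by (simp add: euclidean_continuous_iff[OF X])
  have "\<exists>\<delta>>0. \<forall>y. dst (tensor X) P (tens X n y) < \<delta> \<longrightarrow>
    (y \<in> pts X \<longrightarrow> dist (tensor_lift f P) (tensor_lift f (tens X n y)) < \<epsilon>)" for n
  proof -
    consider "m = n" | "m \<noteq> n" "x = corner X n" | "m \<noteq> n" "x \<noteq> corner X n" by blast
    then show ?thesis
    proof cases
      case 1
      obtain \<delta> where "\<delta> > 0" "\<forall>y\<in>pts X. dst X x y < \<delta> \<longrightarrow> dist (f x) (f y) < \<epsilon>"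
        using cont'[OF x] by blast
      moreover have "dist (tensor_lift f P) (tensor_lift f (tens X n y)) \<le> dist (f x) (f y)"
        if "y \<in> pts X" for y
        using that x by (simp add: P 1 tensor_lift_tens[OF f] dist_contraction)
      ultimately show ?thesis
        \<comment> \<open>Halved because the tensor product halves distances within a copy.\<close>
        using x by (intro exI[of _ "\<delta> / 2"]) (auto simp: P 1 dst_tens_same[OF X], blast intro: le_less_trans)
    next
      case 2
      \<comment> \<open>At the junction the point is also represented by \<open>corner X m\<close>
        in copy n, so continuity of f is needed at that corner.\<close>
      obtain \<delta> where "\<delta> > 0"
        and \<delta>: "\<forall>y\<in>pts X. dst X (corner X m) y < \<delta> \<longrightarrow> dist (f (corner X m)) (f y) < \<epsilon>"
        using cont'[OF corner] by blast
      have "dist (tensor_lift f P) (tensor_lift f (tens X n y)) < \<epsilon>"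
        if y: "y \<in> pts X" and less: "dst (tensor X) P (tens X n y) < min (\<delta> / 2) (1 / 2)" for y
      proof -
        have "dst X x (corner X n) + dst X (corner X m) y < 2 * min (\<delta> / 2) (1 / 2)"
          using dst_tens_less[OF X x y 2(1) less[unfolded P]] by simp
        then have "dst X (corner X m) y < \<delta>"
          using nonneg[of x "corner X n"] by linarith
        then have "dist (vertex m) (f y) < \<epsilon>"
          using \<delta> y f by metis
        moreover have "tensor_lift f P = contraction n (vertex m)"
          using x by (simp add: P 2(2) tensor_lift_tens[OF f] f contraction_vertex_commute)
        ultimately show ?thesis
          using y \<epsilon>
          unfolding tensor_lift_tens[OF f y] by (simp add: dist_contraction)
      qed
      then show ?thesis
        using \<open>\<delta> > 0\<close> by (intro exI[of _ "min (\<delta> / 2) (1 / 2)"]) auto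
    next
      case 3
      \<comment> \<open>Away from the junction, copy n has positive distance from the point, so a
        small \<delta> makes the claim vacuous.\<close>
      have pos: "dst X x (corner X n) > 0"
        using 3 x corner by (simp add: mdist_pos_eq)
      have "\<not> dst (tensor X) P (tens X n y) < min (dst X x (corner X n) / 2) (1 / 2)"
        if y: "y \<in> pts X" for y
      proof
        assume "dst (tensor X) P (tens X n y) < min (dst X x (corner X n) / 2) (1 / 2)"
        from dst_tens_less[OF X x y 3(1) this[unfolded P] min.cobounded2]
        show False using nonneg[of "corner X m" y] by linarith
      qed
      then show ?thesis
        using pos by (intro exI[of _ "min (dst X x (corner X n) / 2) (1 / 2)"]) auto
    qed
  qed
  then obtain \<delta> where "\<delta> > 0" "\<And>n y. dst (tensor X) P (tens X n y) < \<delta> \<Longrightarrow>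
    (y \<in> pts X \<longrightarrow> dist (tensor_lift f P) (tensor_lift f (tens X n y)) < \<epsilon>)"
    by (rule uniform_over_copies[where d = "\<lambda>n y. dst (tensor X) P (tens X n y)"]) blast
  then show "\<exists>\<delta>>0. \<forall>Q\<in>pts (tensor X). dst (tensor X) P Q < \<delta> \<longrightarrow>
      dist (tensor_lift f P) (tensor_lift f Q) < \<epsilon>"
    by (metis tensor_cases)
qed

section \<open>Finality\<close>

context
  fixes X :: "'a tri_space" and e
  assumes coalg: "coalgebra X e"
begin

private lemma X: "tri_metric X"
  and e_cont: "continuous_map (tri_top X) (tri_top (tensor X)) e"
  and e_corner: "e (corner X m) = tens X m (corner X m)"
  using coalg by (auto simp: coalgebra_def tri_morphism_iff corner_tensor)

private lemma corner_in: "corner X m \<in> pts X"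
  using X by (simp add: tri_metric_iff)

private lemma e_cases:
  assumes "x \<in> pts X"
  obtains m y where "y \<in> pts X" "e x = tens X m y"
proof -
  have "e x \<in> pts (tensor X)"
    using e_cont assms by (simp add: tri_top_continuous_iff X tri_metric_tensor image_subset_iff)
  then show thesis
    by (metis tensor_cases that)
qed

text \<open>Both sides of the morphism equation are values of \<sigma>, which is injective on the
  gasket. Cancelling it leaves an equation in the plane, to which limits and distance estimates
  apply.\<close>

private lemma coalgebra_morphism_gasket:
  "coalgebra_morphism X e gasket gasket_sigma f \<longleftrightarrow>
     continuous_map (tri_top X) euclidean f \<and> f ` pts X \<subseteq> sierpinski \<and>
     (\<forall>m. f (corner X m) = vertex m) \<and>
     (\<forall>m. \<forall>x\<in>pts X. \<forall>y\<in>pts X. e x = tens X m y \<longrightarrow> f x = contraction m (f y))"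
proof -
  have "(\<forall>x\<in>pts X. gasket_sigma (f x) = tensor_map gasket f (e x)) \<longleftrightarrow>
     (\<forall>m. \<forall>x\<in>pts X. \<forall>y\<in>pts X. e x = tens X m y \<longrightarrow> f x = contraction m (f y))"
    if f: "f ` pts X \<subseteq> sierpinski" "\<forall>m. f (corner X m) = vertex m"
  proof -
    have map: "tensor_map gasket f (tens X m y) = gasket_sigma (contraction m (f y))"
      if "y \<in> pts X" for m y
    proof -
      have "tensor_map gasket f (tens X m y) = tens gasket m (f y)"
        using f(2) tri_metric_gasket that f(1)
        by (intro tensor_map_tens) (auto simp: all_idx tri_metric_def simp flip: corner.simps)
      then show ?thesis using that f(1) by (subst gasket_sigma_contraction) auto
    qed
    \<comment> \<open>Applying \<tau> recovers the point.\<close>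
    have inj: "gasket_sigma p = gasket_sigma q \<longleftrightarrow> p = q" if "p \<in> sierpinski" "q \<in> sierpinski" for p q
      using that gasket_sigma_contraction gasket_tau_tens by (metis sierpinski_cases)
    show ?thesis
    proof (intro iffI ballI allI impI)
      fix m x y
      assume "\<forall>x\<in>pts X. gasket_sigma (f x) = tensor_map gasket f (e x)"
        "x \<in> pts X" "y \<in> pts X" "e x = tens X m y"
      then show "f x = contraction m (f y)"
        using map inj f(1) contraction_sierpinski by (metis image_subset_iff)
    next
      fix x
      assume *: "\<forall>m. \<forall>x\<in>pts X. \<forall>y\<in>pts X. e x = tens X m y \<longrightarrow> f x = contraction m (f y)"
        "x \<in> pts X"
      then obtain m y where "y \<in> pts X" "e x = tens X m y"
        using e_cases by blast
      then show "gasket_sigma (f x) = tensor_map gasket f (e x)"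
        using * map by metis
    qed
  qed
  then show ?thesis
    by (auto simp: coalgebra_morphism_def tri_morphism_iff tri_top_gasket
        continuous_map_in_subtopology X image_subset_iff Pi_iff)
qed

section \<open>Uniqueness of the morphism\<close>

private lemma coalgebra_morphism_unique:
  assumes "coalgebra_morphism X e gasket gasket_sigma f"
    and "coalgebra_morphism X e gasket gasket_sigma g" and x: "x \<in> pts X"
  shows "f x = g x"
proof -
  have fg: "h ` pts X \<subseteq> sierpinski"
      "\<And>m x y. x \<in> pts X \<Longrightarrow> y \<in> pts X \<Longrightarrow> e x = tens X m y \<Longrightarrow> h x = contraction m (h y)"
    if "h \<in> {f, g}" for h
    using that assms(1,2) unfolding coalgebra_morphism_gasket by blast+
  \<comment> \<open>Both maps follow the same index m and the same y, so each unfolding of e halves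
    the distance, starting from the diameter bound 1.\<close>
  have "dist (f x) (g x) \<le> 1 / 2 ^ n" if "x \<in> pts X" for n x
    using that
  proof (induction n arbitrary: x)
    case 0
    then have "f x \<in> triangle" "g x \<in> triangle"
      using fg(1) sierpinski_subset_triangle by blast+
    then show ?case by (simp add: dist_triangle_le)
  next
    case (Suc n)
    obtain m y where y: "y \<in> pts X" "e x = tens X m y"
      using e_cases[OF Suc.prems] .
    have "f x = contraction m (f y)" "g x = contraction m (g y)"
      by (rule fg(2)[OF _ Suc.prems y]; simp)+
    then show ?case
      using Suc.IH[OF y(1)] by (simp add: dist_contraction)
  qed
  moreover have "(\<lambda>n. 1 / 2 ^ n :: real) \<longlonglongrightarrow> 0"
    by real_asymp
  ultimately have "dist (f x) (g x) \<le> 0"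
    using x by (intro LIMSEQ_le_const) auto
  then show ?thesis by simp
qed

section \<open>Existence of the morphism by successive approximation\<close>

text \<open>The values of the approximants lie in the plane rather than in the gasket, which leaves
  room for the explicit starting map; only their limit takes values in the gasket.\<close>

private fun approx :: "nat \<Rightarrow> 'a \<Rightarrow> real \<times> real" where
  "approx 0 x = (\<Sum>m\<in>{Ma, Mb, Mc}. (1 - dst X x (corner X m)) *\<^sub>R vertex m)"
| "approx (Suc n) x = tensor_lift (approx n) (e x)"

private lemma approx_corner: "approx n (corner X m) = vertex m"
proof (induction n arbitrary: m)
  case 0
  \<comment> \<open>At a corner, the weights of the starting map are thus 1 for its own vertex and 0
    for the two others.\<close>
  have "dst X (corner X m) (corner X k) = (if m = k then 0 else 1)" for k
    using X corner_in by (auto simp: tri_metric_iff Metric_space.mdist_zero)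
  then show ?case by (cases m) auto
next
  case (Suc n)
  then show ?case
    by (simp add: e_corner tensor_lift_tens[OF Suc corner_in])
qed

private lemma approx_Suc:
  assumes "x \<in> pts X" "y \<in> pts X" "e x = tens X m y"
  shows "approx (Suc n) x = contraction m (approx n y)"
  using assms by (simp add: tensor_lift_tens[OF approx_corner])

private lemma approx_continuous: "continuous_map (tri_top X) euclidean (approx n)"
proof (induction n)
  case 0
  interpret Metric_space "pts X" "dst X"
    using X by (simp add: tri_metric_def)
  have "continuous_map (tri_top X) euclidean (\<lambda>x. dst X x (corner X m))" for m
    unfolding euclidean_continuous_iff[OF X]
  proof (intro ballI allI impI)
    fix x and \<epsilon> :: real assume x: "x \<in> pts X" and "\<epsilon> > 0"
    have "dist (dst X x (corner X m)) (dst X y (corner X m)) \<le> dst X x y" if "y \<in> pts X" for y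
      using mdist_reverse_triangle[of x "corner X m" y] x that corner_in
      by (simp add: dist_real_def commute)
    then show "\<exists>\<delta>>0. \<forall>y\<in>pts X. dst X x y < \<delta> \<longrightarrow>
        dist (dst X x (corner X m)) (dst X y (corner X m)) < \<epsilon>"
      using \<open>\<epsilon> > 0\<close> by (intro exI[of _ \<epsilon>]) force
  qed
  moreover have "continuous_map euclideanreal euclidean (\<lambda>t. (1 - t) *\<^sub>R vertex m)" for m
    by (auto intro!: continuous_intros)
  ultimately have "continuous_map (tri_top X) euclidean
      ((\<lambda>t. (1 - t) *\<^sub>R vertex m) \<circ> (\<lambda>x. dst X x (corner X m)))" for m
    by (rule continuous_map_compose)
  then show ?case
    unfolding approx.simps comp_def by (intro continuous_map_sum) auto
next
  case (Suc n)
  then show ?case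
    using continuous_map_compose[OF e_cont continuous_tensor_lift[OF X approx_corner Suc]]
    by (simp add: comp_def)
qed

text \<open>The start is a sum of three vectors of norm at most 1, and the bound 3 persists because
  (3 + 1) / 2 is at most 3.\<close>

private lemma approx_bounded: "x \<in> pts X \<Longrightarrow> norm (approx n x) \<le> 3"
proof (induction n arbitrary: x)
  case 0
  have "norm ((1 - dst X x (corner X m)) *\<^sub>R vertex m) \<le> 1" for m
  proof -
    have "0 \<le> dst X x (corner X m)" "dst X x (corner X m) \<le> 1"
      using X 0 corner_in by (auto simp: tri_metric_iff Metric_space.nonneg)
    then show ?thesis
      using norm_vertex_le[of m] by (simp add: mult_le_one)
  qed
  then show ?case
    using sum_norm_le[of "{Ma, Mb, Mc}" "\<lambda>m. (1 - dst X x (corner X m)) *\<^sub>R vertex m" "\<lambda>_. 1"]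
    by simp
next
  case (Suc n)
  obtain m y where y: "y \<in> pts X" "e x = tens X m y"
    using e_cases[OF Suc.prems] .
  have "norm (approx (Suc n) x) \<le> norm ((1 / 2) *\<^sub>R approx n y) + norm ((1 / 2) *\<^sub>R vertex m)"
    unfolding approx_Suc[OF Suc.prems y] contraction_eq by (rule norm_triangle_ineq)
  then show ?case
    using Suc.IH[OF y(1)] norm_vertex_le[of m] by simp
qed

text \<open>Unfolding e n times leaves the distance of \<open>approx k\<close> and
  \<open>approx 0\<close> at some point, at most 3 + 3, halved n times. The bound is uniform in x
  and k.\<close>

private lemma approx_near:
  assumes "x \<in> pts X"
  shows "dist (approx (n + k) x) (approx n x) \<le> 6 / 2 ^ n"
  using assms
proof (induction n arbitrary: x)
  case 0
  show ?case
    using norm_triangle_ineq4[of "approx k x" "approx 0 x"]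
      approx_bounded[OF 0, of k] approx_bounded[OF 0, of 0]
    unfolding dist_norm by (simp del: approx.simps)
next
  case (Suc n)
  obtain m y where y: "y \<in> pts X" "e x = tens X m y"
    using e_cases[OF Suc.prems] .
  show ?case
    using Suc.IH[OF y(1)]
    by (simp add: approx_Suc[OF Suc.prems y] dist_contraction del: approx.simps)
qed

private lemma coalgebra_morphism_exists: "\<exists>f. coalgebra_morphism X e gasket gasket_sigma f"
proof -
  define f where "f x = lim (\<lambda>n. approx n x)" for x
  have lim: "(\<lambda>n. approx n x) \<longlonglongrightarrow> f x" if "x \<in> pts X" for x
  proof -
    have "Cauchy (\<lambda>n. approx n x)"
      unfolding Cauchy_altdef2
    proof (intro allI impI)
      fix \<epsilon> :: real assume "\<epsilon> > 0"
      moreover have "(\<lambda>n. 6 / 2 ^ n :: real) \<longlonglongrightarrow> 0"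
        by real_asymp
      ultimately have "\<forall>\<^sub>F n in sequentially. 6 / 2 ^ n < \<epsilon>"
        by (metis order_tendstoD(2))
      then obtain N where N: "6 / 2 ^ N < \<epsilon>"
        by (auto simp: eventually_sequentially)
      have "dist (approx n x) (approx N x) < \<epsilon>" if "n \<ge> N" for n
        using approx_near[OF \<open>x \<in> pts X\<close>, of N "n - N"] N that by simp
      then show "\<exists>N. \<forall>n\<ge>N. dist (approx n x) (approx N x) < \<epsilon>" by blast
    qed
    then show ?thesis
      by (simp add: f_def Cauchy_convergent_iff convergent_LIMSEQ_iff)
  qed
  have near: "dist (approx n x) (f x) \<le> 6 / 2 ^ n" if "x \<in> pts X" for n x
  proof -
    \<comment> \<open>Letting k tend to infinity keeps a bound independent of x, so the convergence
      is uniform.\<close>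
    have "(\<lambda>k. dist (approx (k + n) x) (approx n x)) \<longlonglongrightarrow> dist (f x) (approx n x)"
      by (intro tendsto_intros LIMSEQ_ignore_initial_segment lim that)
    then have "dist (f x) (approx n x) \<le> 6 / 2 ^ n"
      using approx_near[OF that, of n] by (intro LIMSEQ_le_const2) (auto simp: add.commute)
    then show ?thesis by (simp add: dist_commute)
  qed
  have cont: "continuous_map (tri_top X) euclidean f"
    unfolding mtopology_is_euclidean[symmetric]
  proof (rule Met_TC.continuous_map_uniform_limit)
    show "\<forall>\<^sub>F n in sequentially. continuous_map (tri_top X) Met_TC.mtopology (approx n)"
      by (simp add: approx_continuous)
    fix \<epsilon> :: real assume "\<epsilon> > 0"
    moreover have "(\<lambda>n. 6 / 2 ^ n :: real) \<longlonglongrightarrow> 0"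
      by real_asymp
    ultimately have "\<forall>\<^sub>F n in sequentially. 6 / 2 ^ n < \<epsilon>"
      by (metis order_tendstoD(2))
    then show "\<forall>\<^sub>F n in sequentially.
        \<forall>x\<in>topspace (tri_top X). f x \<in> UNIV \<and> dist (approx n x) (f x) < \<epsilon>"
      by eventually_elim (use near X in \<open>auto intro: le_less_trans\<close>)
  qed simp
  have corner: "f (corner X m) = vertex m" for m
    by (simp add: f_def approx_corner)
  have step: "f x = contraction m (f y)" if "x \<in> pts X" "y \<in> pts X" "e x = tens X m y" for m x y
  \<comment> \<open>The equation between consecutive approximants passes to the limit by continuity
    of the contraction.\<close>
  proof (rule LIMSEQ_unique)
    show "(\<lambda>n. approx (Suc n) x) \<longlonglongrightarrow> f x"
      using lim[OF that(1)] by (rule LIMSEQ_Suc)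
    show "(\<lambda>n. approx (Suc n) x) \<longlonglongrightarrow> contraction m (f y)"
      unfolding approx_Suc[OF that] contraction_eq by (intro tendsto_intros lim that)
  qed
  have "bounded (f ` pts X)"
    unfolding bounded_iff
  proof (intro exI[of _ 3] ballI)
    fix p assume "p \<in> f ` pts X"
    then obtain x where x: "x \<in> pts X" "p = f x" by blast
    show "norm p \<le> 3"
      unfolding x(2) using tendsto_norm[OF lim[OF x(1)]] approx_bounded[OF x(1)]
      by (intro LIMSEQ_le_const2) auto
  qed
  moreover have "f ` pts X \<subseteq> hutchinson (f ` pts X)"
  proof
    fix p assume "p \<in> f ` pts X"
    then obtain x where x: "x \<in> pts X" "p = f x" by blast
    obtain m y where y: "y \<in> pts X" "e x = tens X m y"
      using e_cases[OF x(1)] .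
    have "p = contraction m (f y)"
      unfolding x(2) by (rule step[OF x(1) y])
    with y(1) show "p \<in> hutchinson (f ` pts X)"
      by (auto simp: hutchinson_def)
  qed
  ultimately have "f ` pts X \<subseteq> sierpinski"
    by (rule subset_sierpinski)
  then show ?thesis
    using cont corner step unfolding coalgebra_morphism_gasket by blast
qed

text \<open>Restricting to the points of X keeps a solution a solution, since continuity and the
  equations concern only points of X. Extensional solutions that agree there are equal.\<close>

lemma coalgebra_morphism_gasket_ex1:
  "\<exists>!f. f \<in> extensional (pts X) \<and> coalgebra_morphism X e gasket gasket_sigma f"
proof -
  obtain f where f: "coalgebra_morphism X e gasket gasket_sigma f"
    using coalgebra_morphism_exists ..
  have "continuous_map (tri_top X) euclidean (restrict f (pts X))"
    using f X continuous_map_eq[of "tri_top X" euclidean f "restrict f (pts X)"]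
    by (simp add: coalgebra_morphism_gasket)
  with f have "coalgebra_morphism X e gasket gasket_sigma (restrict f (pts X))"
    by (auto simp: coalgebra_morphism_gasket corner_in)
  then show ?thesis
    using coalgebra_morphism_unique
    by (intro ex1I[of _ "restrict f (pts X)"]) (auto intro: extensionalityI)
qed

end

theorem theorem4:
  shows "final_coalgebra TYPE('a) gasket gasket_sigma"
  unfolding final_coalgebra_def
  using coalgebra_gasket coalgebra_morphism_gasket_ex1 by blast

end
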